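(* Let $(U,\oplus,\odot,\underline{0},\underline{1},\geq,>,\mathsf{mono},\mathsf{max}_0)$ be an ordered semiring with max. Let $\mathcal{F}$ be a signature and $\mathcal{V}$ a set of variables, and let $\mathcal{P}ol$ be a polynomial interpretation assigning to every $n$-ary symbol $f\in\mathcal{F}$ a linear polynomial $[f](x_1,\dots,x_n)=f_0\oplus f_1\odot x_1\oplus\cdots\oplus f_n\odot x_n$ with $f_0,\dots,f_n\in U$ such that $f_i\geq\underline{0}$ for all $1\leq i\leq n$ (no condition is imposed on $f_0$). Let $\succsim_{\mathcal{P}ol}$ and $\succ_{\mathcal{P}ol}$ be the relations on terms over $\mathcal{F}$ and $\mathcal{V}$ induced by the interpretation in which each $f$ is interpreted by $\mathsf{max}_0([f](x_1,\dots,x_n))$ (see context). Then $(\succsim_{\mathcal{P}ol},\succ_{\mathcal{P}ol})$ is a reduction pair, where $s\succ_{\mathcal{P}ol}t$ can be approximated by $[s]_{\mathit{left}}>[t]_{\mathit{right}}$ and $s\succsim_{\mathcal{P}ol}t$ can be approximated by $[s]_{\mathit{left}}\geq[t]_{\mathit{right}}$; that is, for all terms $s,t$: if $[s]_{\mathit{left}}>[t]_{\mathit{right}}$ then $s\succ_{\mathcal{P}ol}t$, and if $[s]_{\mathit{left}}\geq[t]_{\mathit{right}}$ then $s\succsim_{\mathcal{P}ol}t$.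
   Context: Semiring with one-element: a structure $(U,\oplus,\odot,\underline{0},\underline{1})$ with binary operations $\oplus,\odot$ on $U$ and $\underline{0},\underline{1}\in U$ such that $\oplus$ and $\odot$ are associative, $\oplus$ is commutative, $\underline{0}\neq\underline{1}$, $\underline{0}$ is neutral for $\oplus$, $\underline{1}$ is neutral for $\odot$, $\underline{0}\odot x=x\odot\underline{0}=\underline{0}$, and $\odot$ distributes over $\oplus$ on both sides. ($\odot$ need not be commutative.) Ordered semiring: a structure $(U,\oplus,\odot,\underline{0},\underline{1},\geq,>,\mathsf{mono})$, with $\geq$ (a non-strict order) and $>$ (a strict order) binary relations and $\mathsf{mono}$ a unary predicate on $U$, such that $(U,\oplus,\odot,\underline{0},\underline{1})$ is a semiring with one-element and - $\geq$ is reflexive and transitive; $>$ is transitive; ${>}\circ{\geq}\subseteq{>}$ and ${\geq}\circ{>}\subseteq{>}$ (i.e. $x>y\geq z$ implies $x>z$, and $x\geq y>z$ implies $x>z$); - $\underline{1}\geq\underline{0}$ and $\mathsf{mono}(\underline{1})$; - if $x\geq y$ then $x\oplus z\geq y\oplus z$; if $x>y$ then $x\oplus z>y\oplus z$; - if $x\geq y$ and $z\geq\underline{0}$ then $x\odot z\geq y\odot z$ and $z\odot x\geq z\odot y$; - if $\mathsf{mono}(x)$, $x\geq\underline{0}$ and $y>z$ then $x\odot y>x\odot z$; - $\{(x,y)\mid x>y\wedge y\geq\underline{0}\}$ is well-founded, i.e. there is no infinite sequence $x_1>x_2>x_3>\cdots$ with $x_i\geq\underline{0}$ for all $i\geq2$.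 Ordered semiring with max: an ordered semiring together with a unary operation $\mathsf{max}_0:U\to U$ such that for all $x,y\in U$: $\mathsf{max}_0(x)\geq\underline{0}$ and $\mathsf{max}_0(x)\geq x$; and $y\geq x\geq\underline{0}$ implies $\mathsf{max}_0(y)\geq\mathsf{max}_0(x)=x$. Induced relations: an assignment is a map $\alpha:\mathcal{V}\to\{u\in U\mid u\geq\underline{0}\}$. The value of a term is $[x]_\alpha=\alpha(x)$ for variables $x$ and $[f(t_1,\dots,t_n)]_\alpha=\mathsf{max}_0(f_0\oplus f_1\odot[t_1]_\alpha\oplus\cdots\oplus f_n\odot[t_n]_\alpha)$. Define $s\succ_{\mathcal{P}ol}t$ iff $[s]_\alpha>[t]_\alpha$ for all assignments $\alpha$, and $s\succsim_{\mathcal{P}ol}t$ iff $[s]_\alpha\geq[t]_\alpha$ for all assignments $\alpha$. Approximations: $[t]_{\mathit{left}}$ and $[t]_{\mathit{right}}$ are formal linear polynomials $c\oplus\bigoplus_{x}a_x\odot x$ over variables $x\in\mathcal{V}$ (finitely many $a_x\ne\underline 0$). Let $\mathsf{cp}(p)=c$ denote the constant part and $\mathsf{ncp}(p)=\bigoplus_x a_x\odot x$ the non-constant part of such a polynomial $p$; $\mathsf{ncp}(p)=\underline{0}$ means all $a_x=\underline{0}$. For variables, $[x]_{\mathit{left}}=[x]_{\mathit{right}}=x$. For $t=f(t_1,\dots,t_n)$ put $p_{\mathit{left}}=[f]([t_1]_{\mathit{left}},\dots,[t_n]_{\mathit{left}})$ and $p_{\mathit{right}}=[f]([t_1]_{\mathit{right}},\dots,[t_n]_{\mathit{right}})$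 (with $[f]$ the linear polynomial, without $\mathsf{max}_0$, expanded by distributivity), and define $[t]_{\mathit{left}}=\mathsf{max}_0(\mathsf{cp}(p_{\mathit{left}}))$ if $\mathsf{ncp}(p_{\mathit{left}})=\underline{0}$ and $[t]_{\mathit{left}}=p_{\mathit{left}}$ otherwise; $[t]_{\mathit{right}}=\mathsf{ncp}(p_{\mathit{right}})\oplus\mathsf{max}_0(\mathsf{cp}(p_{\mathit{right}}))$. For such polynomials $p,q$, $p>q$ (resp. $p\geq q$) means that the value of $p$ is $>$ (resp. $\geq$) the value of $q$ under every assignment $\alpha$. Reduction pair: a pair $(\succsim,\succ)$ of partial orders on terms (understood as transitive relations; antisymmetry of $\succsim$ is not required) such that $\succsim$ and $\succ$ are stable (closed under substitutions), $\succsim$ is reflexive and monotone (closed under contexts), $\succ$ is well-founded (no infinite sequence $t_1\succ t_2\succ\cdots$), and ${\succsim}\circ{\succ}\subseteq{\succ}$.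
   Formalization: The formal theorem additionally assumes that max_0 is monotone on all of U (y ≥ x implies max_0(y) ≥ max_0(x), also when x is not ≥ 0); without this the statement is false, e.g. over the integers with max_0(-1)=100. *)

theory Defs
  imports Main "HOL-Library.FuncSet" "HOL-Library.Poly_Mapping"
begin

subsection \<open>Ordered semirings\<close>

text \<open>The semiring with one-element is the type class \<^class>\<open>semiring_1\<close> (whose multiplication
  need not commute). The orders are parameters: \<open>geq\<close> is only a preorder, and it is not tied to
  \<open>gt\<close> in the way the order type classes would require.\<close>

locale mono_ordered_semiring =
  fixes geq gt :: "'a::semiring_1 \<Rightarrow> 'a \<Rightarrow> bool"
    and is_mono :: "'a \<Rightarrow> bool"
  assumes geq_refl: "geq x x"
    and geq_trans: "geq x y \<Longrightarrow> geq y z \<Longrightarrow> geq x z"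
    and gt_trans: "gt x y \<Longrightarrow> gt y z \<Longrightarrow> gt x z"
    and gt_geq_trans: "gt x y \<Longrightarrow> geq y z \<Longrightarrow> gt x z"
    and geq_gt_trans: "geq x y \<Longrightarrow> gt y z \<Longrightarrow> gt x z"
    and one_geq_zero: "geq 1 0"
    and is_mono_one: "is_mono 1"
    and plus_geq: "geq x y \<Longrightarrow> geq (x + z) (y + z)"
    and plus_gt: "gt x y \<Longrightarrow> gt (x + z) (y + z)"
    and times_geq_right: "geq x y \<Longrightarrow> geq z 0 \<Longrightarrow> geq (x * z) (y * z)"
    and times_geq_left: "geq x y \<Longrightarrow> geq z 0 \<Longrightarrow> geq (z * x) (z * y)"
    and times_gt_left: "is_mono x \<Longrightarrow> geq x 0 \<Longrightarrow> gt y z \<Longrightarrow> gt (x * y) (x * z)"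
    and wf_gt: "wf {(y, x). gt x y \<and> geq y 0}"

locale mono_ordered_semiring_max = mono_ordered_semiring geq gt is_mono
  for geq gt :: "'a::semiring_1 \<Rightarrow> 'a \<Rightarrow> bool"
    and is_mono :: "'a \<Rightarrow> bool" +
  fixes max0 :: "'a \<Rightarrow> 'a"
  assumes max0_nonneg: "geq (max0 x) 0"
    and max0_upper: "geq (max0 x) x"
    and max0_above: "geq y x \<Longrightarrow> geq x 0 \<Longrightarrow> geq (max0 y) (max0 x) \<and> max0 x = x"

text \<open>The axioms of \<^locale>\<open>mono_ordered_semiring_max\<close> do not imply that \<open>max0\<close> is monotone on
  arguments that are not \<open>geq\<close> \<open>0\<close>, and without this neither closure under contexts nor the
  soundness of the approximations holds. Over the integers with the usual orders and
  \<open>is_mono x \<longleftrightarrow> 1 \<le> x\<close>, let \<open>max0 (-1) = 100\<close> and \<open>max0 x = max 0 x\<close> otherwise; all axioms hold.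
  Interpret constants \<open>a\<close>, \<open>b\<close> by \<open>2\<close>, \<open>1\<close> and a unary \<open>f\<close> by \<open>-2 + x\<close>. Then \<open>a\<close> is at least \<open>b\<close>,
  but \<open>f(a)\<close> has value \<open>0\<close> and \<open>f(b)\<close> has value \<open>100\<close>; and \<open>f(x)\<close> is approximated from above by
  \<open>x\<close>, but has value \<open>100\<close> at \<open>x = 1\<close>. Monotonicity of \<open>max0\<close> is therefore a separate notion, to be
  assumed where it is needed.\<close>

definition max0_monotone :: "('a \<Rightarrow> 'a \<Rightarrow> bool) \<Rightarrow> ('a \<Rightarrow> 'a) \<Rightarrow> bool" where
  "max0_monotone geq max0 \<longleftrightarrow> (\<forall>x y. geq y x \<longrightarrow> geq (max0 y) (max0 x))"


subsection \<open>Terms\<close>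

datatype ('f, 'v) trm = Var 'v | Fun 'f "('f, 'v) trm list"

text \<open>The terms over the signature \<open>F\<close>, with arities \<open>ar\<close>, and the variables \<open>V\<close>.\<close>

inductive_set terms :: "'f set \<Rightarrow> ('f \<Rightarrow> nat) \<Rightarrow> 'v set \<Rightarrow> ('f, 'v) trm set"
  for F :: "'f set" and ar :: "'f \<Rightarrow> nat" and V :: "'v set"
where
  Var: "x \<in> V \<Longrightarrow> Var x \<in> terms F ar V"
| Fun: "f \<in> F \<Longrightarrow> length ts = ar f \<Longrightarrow> \<forall>t\<in>set ts. t \<in> terms F ar V \<Longrightarrow> Fun f ts \<in> terms F ar V"

primrec subst :: "('v \<Rightarrow> ('f, 'v) trm) \<Rightarrow> ('f, 'v) trm \<Rightarrow> ('f, 'v) trm" where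
  "subst \<sigma> (Var x) = \<sigma> x"
| "subst \<sigma> (Fun f ts) = Fun f (map (subst \<sigma>) ts)"

datatype ('f, 'v) ctxt =
  Hole | More 'f "('f, 'v) trm list" "('f, 'v) ctxt" "('f, 'v) trm list"

primrec plug :: "('f, 'v) ctxt \<Rightarrow> ('f, 'v) trm \<Rightarrow> ('f, 'v) trm" where
  "plug Hole t = t"
| "plug (More f us C vs) t = Fun f (us @ plug C t # vs)"

inductive_set ctxts :: "'f set \<Rightarrow> ('f \<Rightarrow> nat) \<Rightarrow> 'v set \<Rightarrow> ('f, 'v) ctxt set"
  for F :: "'f set" and ar :: "'f \<Rightarrow> nat" and V :: "'v set"
where
  Hole: "Hole \<in> ctxts F ar V"
| More: "f \<in> F \<Longrightarrow> Suc (length us + length vs) = ar f \<Longrightarrow>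
    set us \<subseteq> terms F ar V \<Longrightarrow> set vs \<subseteq> terms F ar V \<Longrightarrow> C \<in> ctxts F ar V \<Longrightarrow>
    More f us C vs \<in> ctxts F ar V"


subsection \<open>Reduction pairs\<close>

definition stable ::
    "'f set \<Rightarrow> ('f \<Rightarrow> nat) \<Rightarrow> 'v set \<Rightarrow> (('f, 'v) trm \<times> ('f, 'v) trm) set \<Rightarrow> bool" where
  "stable F ar V R \<longleftrightarrow>
    (\<forall>(s, t)\<in>R. \<forall>\<sigma>\<in>V \<rightarrow> terms F ar V. (subst \<sigma> s, subst \<sigma> t) \<in> R)"

definition ctxt_closed ::
    "'f set \<Rightarrow> ('f \<Rightarrow> nat) \<Rightarrow> 'v set \<Rightarrow> (('f, 'v) trm \<times> ('f, 'v) trm) set \<Rightarrow> bool" where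
  "ctxt_closed F ar V R \<longleftrightarrow>
    (\<forall>(s, t)\<in>R. \<forall>C\<in>ctxts F ar V. (plug C s, plug C t) \<in> R)"

text \<open>The strict relation \<open>S\<close> is written with the larger term first, hence the converse in the
  well-foundedness condition.\<close>

definition reduction_pair ::
    "'f set \<Rightarrow> ('f \<Rightarrow> nat) \<Rightarrow> 'v set \<Rightarrow> (('f, 'v) trm \<times> ('f, 'v) trm) set \<Rightarrow>
     (('f, 'v) trm \<times> ('f, 'v) trm) set \<Rightarrow> bool" where
  "reduction_pair F ar V NS S \<longleftrightarrow>
    NS \<subseteq> terms F ar V \<times> terms F ar V \<and> S \<subseteq> terms F ar V \<times> terms F ar V \<and>
    trans NS \<and> trans S \<and>
    stable F ar V NS \<and> stable F ar V S \<and>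
    refl_on (terms F ar V) NS \<and> ctxt_closed F ar V NS \<and>
    wf (S\<inverse>) \<and>
    NS O S \<subseteq> S"


subsection \<open>Linear polynomial interpretations\<close>

text \<open>An interpretation \<open>I\<close> maps \<open>f\<close> and \<open>i\<close> to the coefficient \<open>f\<^sub>i\<close>; index \<open>0\<close> is the constant part.
  Argument lists are indexed from \<open>0\<close>, so argument number \<open>i\<close> has coefficient \<open>I f (Suc i)\<close>.\<close>

definition lin_val :: "('f \<Rightarrow> nat \<Rightarrow> 'a::semiring_1) \<Rightarrow> 'f \<Rightarrow> 'a list \<Rightarrow> 'a" where
  "lin_val I f us = I f 0 + (\<Sum>i<length us. I f (Suc i) * us ! i)"

primrec val :: "('a \<Rightarrow> 'a) \<Rightarrow> ('f \<Rightarrow> nat \<Rightarrow> 'a::semiring_1) \<Rightarrow> ('v \<Rightarrow> 'a) \<Rightarrow> ('f, 'v) trm \<Rightarrow> 'a" where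
  "val max0 I \<alpha> (Var x) = \<alpha> x"
| "val max0 I \<alpha> (Fun f ts) = max0 (lin_val I f (map (val max0 I \<alpha>) ts))"

text \<open>Values outside \<open>V\<close> are irrelevant, since they never occur in the value of a term over \<open>V\<close>.\<close>

definition assignments :: "('a::zero \<Rightarrow> 'a \<Rightarrow> bool) \<Rightarrow> 'v set \<Rightarrow> ('v \<Rightarrow> 'a) set" where
  "assignments geq V = V \<rightarrow> {u. geq u 0}"

text \<open>The relation on terms induced by \<open>rel\<close>, which is \<open>geq\<close> or \<open>gt\<close>.\<close>

definition pol_rel ::
    "('a::semiring_1 \<Rightarrow> 'a \<Rightarrow> bool) \<Rightarrow> ('a \<Rightarrow> 'a) \<Rightarrow> 'f set \<Rightarrow> ('f \<Rightarrow> nat) \<Rightarrow> 'v set \<Rightarrow>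
     ('f \<Rightarrow> nat \<Rightarrow> 'a) \<Rightarrow> ('a \<Rightarrow> 'a \<Rightarrow> bool) \<Rightarrow> (('f, 'v) trm \<times> ('f, 'v) trm) set" where
  "pol_rel geq max0 F ar V I rel =
    {(s, t) \<in> terms F ar V \<times> terms F ar V.
      \<forall>\<alpha>\<in>assignments geq V. rel (val max0 I \<alpha> s) (val max0 I \<alpha> t)}"


subsection \<open>Approximations by formal linear polynomials\<close>

type_synonym ('v, 'a) lpoly = "'a \<times> ('v \<Rightarrow>\<^sub>0 'a)"

abbreviation cp :: "('v, 'a::zero) lpoly \<Rightarrow> 'a" where "cp \<equiv> fst"

abbreviation ncp :: "('v, 'a::zero) lpoly \<Rightarrow> ('v \<Rightarrow>\<^sub>0 'a)" where "ncp \<equiv> snd"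

definition lpoly_val :: "('v \<Rightarrow> 'a::semiring_1) \<Rightarrow> ('v, 'a) lpoly \<Rightarrow> 'a" where
  "lpoly_val \<alpha> p =
    cp p + (\<Sum>x\<in>Poly_Mapping.keys (ncp p). Poly_Mapping.lookup (ncp p) x * \<alpha> x)"

text \<open>The polynomial of \<open>f\<close> applied to polynomials, expanded by distributivity.\<close>

definition lin_lpoly ::
    "('f \<Rightarrow> nat \<Rightarrow> 'a::semiring_1) \<Rightarrow> 'f \<Rightarrow> ('v, 'a) lpoly list \<Rightarrow> ('v, 'a) lpoly" where
  "lin_lpoly I f ps =
    (I f 0 + (\<Sum>i<length ps. I f (Suc i) * cp (ps ! i)),
     \<Sum>i<length ps. Poly_Mapping.map ((*) (I f (Suc i))) (ncp (ps ! i)))"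

primrec left :: "('a \<Rightarrow> 'a) \<Rightarrow> ('f \<Rightarrow> nat \<Rightarrow> 'a::semiring_1) \<Rightarrow> ('f, 'v) trm \<Rightarrow> ('v, 'a) lpoly" where
  "left max0 I (Var x) = (0, Poly_Mapping.single x 1)"
| "left max0 I (Fun f ts) =
    (let p = lin_lpoly I f (map (left max0 I) ts)
     in if ncp p = 0 then (max0 (cp p), 0) else p)"

primrec right :: "('a \<Rightarrow> 'a) \<Rightarrow> ('f \<Rightarrow> nat \<Rightarrow> 'a::semiring_1) \<Rightarrow> ('f, 'v) trm \<Rightarrow> ('v, 'a) lpoly" where
  "right max0 I (Var x) = (0, Poly_Mapping.single x 1)"
| "right max0 I (Fun f ts) =
    (let p = lin_lpoly I f (map (right max0 I) ts)
     in (max0 (cp p), ncp p))"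

definition lpoly_rel ::
    "('a::semiring_1 \<Rightarrow> 'a \<Rightarrow> bool) \<Rightarrow> 'v set \<Rightarrow> ('a \<Rightarrow> 'a \<Rightarrow> bool) \<Rightarrow>
     ('v, 'a) lpoly \<Rightarrow> ('v, 'a) lpoly \<Rightarrow> bool" where
  "lpoly_rel geq V rel p q \<longleftrightarrow>
    (\<forall>\<alpha>\<in>assignments geq V. rel (lpoly_val \<alpha> p) (lpoly_val \<alpha> q))"

end

theory Submission
  imports Defs
begin

text \<open>Values of terms are always \<open>geq\<close> \<open>0\<close>, so the induced relations inherit transitivity and
  well-foundedness from \<open>U\<close>, evaluating at the assignment constantly \<open>0\<close> for the latter. Stability
  is the substitution lemma, and monotonicity holds because all argument coefficients are nonnegative
  and \<open>max0\<close> is monotone. For the approximations, \<open>max0\<close> is the identity on nonnegative elements,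
  and the nonconstant part \<open>n\<close> of a right approximation is nonnegative, whence
  \<open>max0 (c + n) \<le> max0 (max0 c + n) = max0 c + n\<close>.\<close>

text \<open>The non-constant part is evaluated separately because \<open>max0\<close> acts on
  constant parts only and nonnegativity will be shown for the rest alone.\<close>

definition lin_comb :: "('v \<Rightarrow> 'a::semiring_1) \<Rightarrow> ('v \<Rightarrow>\<^sub>0 'a) \<Rightarrow> 'a" where
  "lin_comb \<alpha> q = (\<Sum>x\<in>Poly_Mapping.keys q. Poly_Mapping.lookup q x * \<alpha> x)"

lemma lpoly_val_eq: "lpoly_val \<alpha> p = cp p + lin_comb \<alpha> (ncp p)"
  by (simp add: lpoly_val_def lin_comb_def)

text \<open>Variables outside the support contribute \<open>0\<close>. This gives a common index set
  when a sum or a multiple loses support through cancellation or zero divisors.\<close>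

lemma lin_comb_superset:
  assumes "finite A" and "Poly_Mapping.keys q \<subseteq> A"
  shows "lin_comb \<alpha> q = (\<Sum>x\<in>A. Poly_Mapping.lookup q x * \<alpha> x)"
  unfolding lin_comb_def using assms
  by (intro sum.mono_neutral_left) (auto simp: in_keys_iff)

lemma lin_comb_zero [simp]: "lin_comb \<alpha> 0 = 0"
  by (simp add: lin_comb_def)

lemma lin_comb_single [simp]: "lin_comb \<alpha> (Poly_Mapping.single x 1) = \<alpha> x"
  by (simp add: lin_comb_def)

lemma lin_comb_add: "lin_comb \<alpha> (p + q) = lin_comb \<alpha> p + lin_comb \<alpha> q"
proof -
  let ?A = "Poly_Mapping.keys p \<union> Poly_Mapping.keys q"
  have "Poly_Mapping.keys (p + q) \<subseteq> ?A"
    by (rule Poly_Mapping.keys_add)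
  then show ?thesis
    by (simp add: lin_comb_superset[of ?A] lookup_add distrib_right sum.distrib)
qed

lemma lin_comb_sum: "lin_comb \<alpha> (\<Sum>i\<in>A. q i) = (\<Sum>i\<in>A. lin_comb \<alpha> (q i))"
  by (induction A rule: infinite_finite_induct) (auto simp: lin_comb_add)

lemma lin_comb_smult: "lin_comb \<alpha> (Poly_Mapping.map ((*) c) q) = c * lin_comb \<alpha> q"
proof -
  \<comment> \<open>\<open>Poly_Mapping.map\<close> acts on nonzero coefficients only; elsewhere
    both sides are \<open>0\<close>.\<close>
  have "Poly_Mapping.lookup (Poly_Mapping.map ((*) c) q) x = c * Poly_Mapping.lookup q x" for x
    by (simp add: Poly_Mapping.map.rep_eq when_def)
  moreover from this have "Poly_Mapping.keys (Poly_Mapping.map ((*) c) q) \<subseteq> Poly_Mapping.keys q"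
    by (auto simp: in_keys_iff)
  ultimately show ?thesis
    by (simp add: lin_comb_superset[of "Poly_Mapping.keys q"] sum_distrib_left mult.assoc)
qed

lemma lin_comb_lin_lpoly:
  "lin_comb \<alpha> (ncp (lin_lpoly I f ps)) = (\<Sum>i<length ps. I f (Suc i) * lin_comb \<alpha> (ncp (ps ! i)))"
  by (simp add: lin_lpoly_def lin_comb_sum lin_comb_smult)

text \<open>Coefficients multiply from the left throughout, so distributivity and associativity
  suffice without commutativity of \<open>*\<close>. This lets \<open>lin_val_mono\<close> compare
  formal approximations with values of terms.\<close>

lemma lpoly_val_lin_lpoly: "lpoly_val \<alpha> (lin_lpoly I f ps) = lin_val I f (map (lpoly_val \<alpha>) ps)"
proof -
  have "lpoly_val \<alpha> (lin_lpoly I f ps) = cp (lin_lpoly I f ps) +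
      (\<Sum>i<length ps. I f (Suc i) * lin_comb \<alpha> (ncp (ps ! i)))"
    by (simp add: lpoly_val_eq lin_comb_lin_lpoly)
  also have "\<dots> = lin_val I f (map (lpoly_val \<alpha>) ps)"
    by (simp add: lin_lpoly_def lin_val_def lpoly_val_eq distrib_left sum.distrib add.assoc)
  finally show ?thesis .
qed

lemma val_subst: "val max0 I \<alpha> (subst \<sigma> t) = val max0 I (\<lambda>x. val max0 I \<alpha> (\<sigma> x)) t"
  by (induction t) (auto simp: comp_def intro!: arg_cong[where f = max0] arg_cong[where f = "lin_val I _"])

lemma subst_in_terms:
  assumes "t \<in> terms F ar V" and "\<sigma> \<in> V \<rightarrow> terms F ar V"
  shows "subst \<sigma> t \<in> terms F ar V"
  using assms by (induction rule: terms.induct) (auto intro!: terms.Fun)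

lemma plug_in_terms:
  assumes "C \<in> ctxts F ar V" and "t \<in> terms F ar V"
  shows "plug C t \<in> terms F ar V"
  using assms by (induction rule: ctxts.induct) (auto intro!: terms.Fun)

context mono_ordered_semiring
begin

lemma add_mono: "geq x y \<Longrightarrow> geq u v \<Longrightarrow> geq (x + u) (y + v)"
  using plus_geq[of x y u] plus_geq[of u v y] geq_trans by (simp add: add.commute)

lemma add_nonneg: "geq x 0 \<Longrightarrow> geq y 0 \<Longrightarrow> geq (x + y) 0"
  using add_mono[of x 0 y 0] by simp

lemma mult_nonneg: "geq x 0 \<Longrightarrow> geq y 0 \<Longrightarrow> geq (x * y) 0"
  using times_geq_left[of y 0 x] by simp

lemma sum_mono_geq: "(\<And>i. i \<in> A \<Longrightarrow> geq (g i) (h i)) \<Longrightarrow> geq (sum g A) (sum h A)"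
  by (induction A rule: infinite_finite_induct) (auto intro: geq_refl add_mono)

lemma sum_nonneg_geq: "(\<And>i. i \<in> A \<Longrightarrow> geq (g i) 0) \<Longrightarrow> geq (sum g A) 0"
  using sum_mono_geq[of A g "\<lambda>_. 0"] by simp

lemma lin_val_mono:
  assumes "length us = length vs"
    and "\<And>i. i < length us \<Longrightarrow> geq (I f (Suc i)) 0"
    and "\<And>i. i < length us \<Longrightarrow> geq (us ! i) (vs ! i)"
  shows "geq (lin_val I f us) (lin_val I f vs)"
  unfolding lin_val_def using assms
  by (auto intro!: add_mono geq_refl sum_mono_geq times_geq_left)

end

text \<open>Bundles the hypotheses of the theorem; the coefficient range \<open>{1..ar f}\<close>
  becomes \<open>Suc i\<close> with \<open>i < ar f\<close>, matching list positions.\<close>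

locale linear_interpretation = mono_ordered_semiring_max geq gt is_mono max0
  for geq gt :: "'a::semiring_1 \<Rightarrow> 'a \<Rightarrow> bool"
    and is_mono :: "'a \<Rightarrow> bool"
    and max0 :: "'a \<Rightarrow> 'a" +
  fixes F :: "'f set"
    and ar :: "'f \<Rightarrow> nat"
    and V :: "'v set"
    and I :: "'f \<Rightarrow> nat \<Rightarrow> 'a"
  assumes max0_mono: "geq y x \<Longrightarrow> geq (max0 y) (max0 x)"
    and coeff_nonneg: "f \<in> F \<Longrightarrow> i < ar f \<Longrightarrow> geq (I f (Suc i)) 0"
begin

lemma assignment_nonneg: "\<alpha> \<in> assignments geq V \<Longrightarrow> x \<in> V \<Longrightarrow> geq (\<alpha> x) 0"
  by (auto simp: assignments_def)

lemma val_nonneg: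
  assumes "t \<in> terms F ar V" and "\<alpha> \<in> assignments geq V"
  shows "geq (val max0 I \<alpha> t) 0"
  using assms by (cases rule: terms.cases) (auto simp: assignment_nonneg max0_nonneg)

lemma val_plug_mono:
  assumes "C \<in> ctxts F ar V" and "geq (val max0 I \<alpha> s) (val max0 I \<alpha> t)"
  shows "geq (val max0 I \<alpha> (plug C s)) (val max0 I \<alpha> (plug C t))"
  using assms
proof (induction rule: ctxts.induct)
  case Hole
  then show ?case by simp
next
  case (More f us vs C)
  \<comment> \<open>The argument lists differ only at position \<open>length us\<close>, where the
    induction hypothesis applies; elsewhere \<open>geq_refl\<close> does.\<close>
  then show ?case
    by (auto simp: nth_append nth_Cons' intro!: max0_mono lin_val_mono coeff_nonneg geq_refl)
qed

text \<open>Dropping \<open>max0\<close> can only lower a value, and \<open>left\<close> keeps it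
  exactly where the polynomial is constant and \<open>max0\<close> can be computed.\<close>

lemma val_geq_left:
  assumes "t \<in> terms F ar V"
  shows "geq (val max0 I \<alpha> t) (lpoly_val \<alpha> (left max0 I t))"
  using assms
proof (induction rule: terms.induct)
  case (Var x)
  then show ?case by (simp add: lpoly_val_eq geq_refl)
next
  case (Fun f ts)
  define p where "p = lin_lpoly I f (map (left max0 I) ts)"
  have "geq (lin_val I f (map (val max0 I \<alpha>) ts)) (lpoly_val \<alpha> p)"
    unfolding p_def lpoly_val_lin_lpoly using Fun
    by (intro lin_val_mono) (auto simp: coeff_nonneg)
  then have "geq (val max0 I \<alpha> (Fun f ts)) (max0 (lpoly_val \<alpha> p))"
    by (simp add: max0_mono)
  \<comment> \<open>If \<open>ncp p = 0\<close>, both sides equal \<open>max0 (cp p)\<close>;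
    otherwise the right side is the value of \<open>p\<close> and \<open>max0_upper\<close>
    applies.\<close>
  moreover have "geq (max0 (lpoly_val \<alpha> p)) (lpoly_val \<alpha> (left max0 I (Fun f ts)))"
    using max0_upper[of "lpoly_val \<alpha> p"]
    by (auto simp: Let_def p_def[symmetric] lpoly_val_eq geq_refl)
  ultimately show ?case by (rule geq_trans)
qed

text \<open>Non-constant parts are built from variables and argument coefficients alone; the
  constants \<open>I f 0\<close>, of arbitrary sign, never enter.\<close>

lemma ncp_right_nonneg:
  assumes "t \<in> terms F ar V" and "\<alpha> \<in> assignments geq V"
  shows "geq (lin_comb \<alpha> (ncp (right max0 I t))) 0"
  using assms
  by (induction rule: terms.induct)
    (auto simp: assignment_nonneg Let_def lin_comb_lin_lpoly coeff_nonneg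
      intro!: sum_nonneg_geq mult_nonneg)

lemma right_geq_val:
  assumes "t \<in> terms F ar V" and "\<alpha> \<in> assignments geq V"
  shows "geq (lpoly_val \<alpha> (right max0 I t)) (val max0 I \<alpha> t)"
  using assms(1)
proof (induction rule: terms.induct)
  case (Var x)
  then show ?case by (simp add: lpoly_val_eq geq_refl)
next
  case (Fun f ts)
  define p where "p = lin_lpoly I f (map (right max0 I) ts)"
  define n where "n = lin_comb \<alpha> (ncp p)"
  have right_eq: "right max0 I (Fun f ts) = (max0 (cp p), ncp p)"
    by (simp add: p_def Let_def)
  have "Fun f ts \<in> terms F ar V"
    using Fun by (auto intro: terms.Fun)
  from ncp_right_nonneg[OF this assms(2)] have "geq n 0"
    by (simp add: right_eq n_def del: right.simps)
  then have nonneg: "geq (max0 (cp p) + n) 0"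
    by (simp add: add_nonneg max0_nonneg)
  have "geq (lpoly_val \<alpha> p) (lin_val I f (map (val max0 I \<alpha>) ts))"
    unfolding p_def lpoly_val_lin_lpoly using Fun
    by (intro lin_val_mono) (auto simp: coeff_nonneg)
  moreover have "geq (max0 (cp p) + n) (lpoly_val \<alpha> p)"
    by (simp add: lpoly_val_eq n_def max0_upper plus_geq)
  \<comment> \<open>The smaller argument of \<open>max0\<close> may fail to be nonnegative, a case
    about which \<open>max0_above\<close> says nothing; hence \<open>max0_mono\<close>.\<close>
  ultimately have "geq (max0 (max0 (cp p) + n)) (val max0 I \<alpha> (Fun f ts))"
    using geq_trans max0_mono by auto
  \<comment> \<open>\<open>max0_above\<close> with both arguments equal makes \<open>max0\<close>
    the identity on nonnegative elements.\<close>
  moreover have "max0 (max0 (cp p) + n) = max0 (cp p) + n"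
    using max0_above[OF geq_refl nonneg] by simp
  ultimately show ?case
    by (simp add: right_eq lpoly_val_eq n_def del: right.simps)
qed

lemma stable_pol_rel: "stable F ar V (pol_rel geq max0 F ar V I rel)"
  unfolding stable_def
proof safe
  fix s t and \<sigma> :: "'v \<Rightarrow> ('f, 'v) trm"
  assume st: "(s, t) \<in> pol_rel geq max0 F ar V I rel" and \<sigma>: "\<sigma> \<in> V \<rightarrow> terms F ar V"
  \<comment> \<open>Substituting amounts to changing the assignment, and the new one is admissible
    because values of terms are nonnegative.\<close>
  have "(\<lambda>x. val max0 I \<alpha> (\<sigma> x)) \<in> assignments geq V" if "\<alpha> \<in> assignments geq V" for \<alpha>
    using that \<sigma> val_nonneg by (auto simp: assignments_def Pi_iff)
  then show "(subst \<sigma> s, subst \<sigma> t) \<in> pol_rel geq max0 F ar V I rel"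
    using st \<sigma> by (auto simp: pol_rel_def val_subst subst_in_terms)
qed

lemma wf_pol_rel: "wf ((pol_rel geq max0 F ar V I gt)\<inverse>)"
proof -
  have "(\<lambda>_. 0) \<in> assignments geq V"
    by (simp add: assignments_def geq_refl)
  \<comment> \<open>The side condition \<open>geq y 0\<close> concerns the value of the smaller term
    and follows from \<open>val_nonneg\<close>.\<close>
  then have "(pol_rel geq max0 F ar V I gt)\<inverse> \<subseteq>
      inv_image {(y, x). gt x y \<and> geq y 0} (val max0 I (\<lambda>_. 0))"
    by (auto simp: pol_rel_def val_nonneg)
  then show ?thesis
    using wf_subset wf_inv_image wf_gt by blast
qed

lemma reduction_pair_pol_rel:
  "reduction_pair F ar V (pol_rel geq max0 F ar V I geq) (pol_rel geq max0 F ar V I gt)"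
  unfolding reduction_pair_def
proof (intro conjI)
  let ?NS = "pol_rel geq max0 F ar V I geq" and ?S = "pol_rel geq max0 F ar V I gt"
  show "?NS \<subseteq> terms F ar V \<times> terms F ar V" "?S \<subseteq> terms F ar V \<times> terms F ar V"
    by (auto simp: pol_rel_def)
  show "trans ?NS" "trans ?S"
    unfolding trans_def pol_rel_def by (blast intro: geq_trans gt_trans)+
  show "stable F ar V ?NS" "stable F ar V ?S"
    by (rule stable_pol_rel)+
  show "refl_on (terms F ar V) ?NS"
    by (auto simp: refl_on_def pol_rel_def geq_refl)
  show "ctxt_closed F ar V ?NS"
    by (auto simp: ctxt_closed_def pol_rel_def plug_in_terms val_plug_mono)
  show "wf (?S\<inverse>)"
    by (rule wf_pol_rel)
  show "?NS O ?S \<subseteq> ?S"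
    unfolding pol_rel_def by (blast intro: geq_gt_trans)
qed

text \<open>The values of the approximations lie between those of \<open>s\<close> and
  \<open>t\<close>; \<open>gt\<close> absorbs \<open>geq\<close> on either side.\<close>

lemma pol_rel_gt_approximation:
  assumes "s \<in> terms F ar V" and "t \<in> terms F ar V"
    and "lpoly_rel geq V gt (left max0 I s) (right max0 I t)"
  shows "(s, t) \<in> pol_rel geq max0 F ar V I gt"
  using assms val_geq_left[of s] right_geq_val[of t] geq_gt_trans gt_geq_trans
  unfolding pol_rel_def lpoly_rel_def by blast

lemma pol_rel_geq_approximation:
  assumes "s \<in> terms F ar V" and "t \<in> terms F ar V"
    and "lpoly_rel geq V geq (left max0 I s) (right max0 I t)"
  shows "(s, t) \<in> pol_rel geq max0 F ar V I geq"
  using assms val_geq_left[of s] right_geq_val[of t] geq_trans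
  unfolding pol_rel_def lpoly_rel_def by blast

end

theorem theorem7:
  fixes geq gt :: "'a::semiring_1 \<Rightarrow> 'a \<Rightarrow> bool"
    and is_mono :: "'a \<Rightarrow> bool"
    and max0 :: "'a \<Rightarrow> 'a"
    and F :: "'f set"
    and ar :: "'f \<Rightarrow> nat"
    and V :: "'v set"
    and I :: "'f \<Rightarrow> nat \<Rightarrow> 'a"
  assumes "mono_ordered_semiring_max geq gt is_mono max0"
    and "max0_monotone geq max0"
    and "\<forall>f\<in>F. \<forall>i\<in>{1..ar f}. geq (I f i) 0"
  shows "reduction_pair F ar V
      (pol_rel geq max0 F ar V I geq) (pol_rel geq max0 F ar V I gt) \<and>
    (\<forall>s\<in>terms F ar V. \<forall>t\<in>terms F ar V.
      (lpoly_rel geq V gt (left max0 I s) (right max0 I t) \<longrightarrow>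
        (s, t) \<in> pol_rel geq max0 F ar V I gt) \<and>
      (lpoly_rel geq V geq (left max0 I s) (right max0 I t) \<longrightarrow>
        (s, t) \<in> pol_rel geq max0 F ar V I geq))"
proof -
  interpret mono_ordered_semiring_max geq gt is_mono max0
    by fact
  interpret linear_interpretation geq gt is_mono max0 F ar V I
    using assms(2,3) by unfold_locales (auto simp: max0_monotone_def)
  show ?thesis
    using reduction_pair_pol_rel pol_rel_gt_approximation pol_rel_geq_approximation by blast
qed

end
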